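(* (a) Let $d\ge1$. If $A\subset[0,1]^d$ is of first category in $[0,1]^d$, then $\mathcal{K}_A=\{E\in\mathcal{K}([0,1]^d): E\cap A\neq\emptyset\}$ is of first category in $(\mathcal{K}([0,1]^d),d_H)$. (b) A typical compact set of $\mathcal{K}([0,1])$ is a subset of the set of non-normal Liouville numbers; that is, the set of all $E\in\mathcal{K}([0,1])$ containing a point which is a normal number or is not a Liouville number is of first category in $(\mathcal{K}([0,1]),d_H)$.
   Context: $\mathcal{K}([0,1]^d)$ denotes the set of all nonempty compact subsets of $[0,1]^d$ with the Hausdorff metric $d_H(E,F)=\inf\{\varepsilon>0: E\subset F^\varepsilon \text{ and } F\subset E^\varepsilon\}$, where $E^\varepsilon=\{x\in\mathbb{R}^d:\operatorname{dist}(x,E)<\varepsilon\}$. A subset of a metric space is nowhere dense if its closure has empty interior, and is of first category if it is a countable union of nowhere dense sets. A typical element of a metric space $X$ has a property if the set of elements of $X$ not having the property is of first category in $X$. A real number is normal if, for every integer base $b\ge2$ and every $k\geq 1$, each block of $k$ digits occurs in its base-$b$ expansion with asymptotic frequency $b^{-k}$. A real number $x$ is a Liouville number if it is irrational and for every positive integer $n$ there are integers $p,q$ with $q>1$ and $|x-p/q|<q^{-n}$. *)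

theory Defs
  imports "HOL-Analysis.Analysis"
begin

section \<open>Baire category in a topological space\<close>

definition nowhere_dense_in :: "'a topology \<Rightarrow> 'a set \<Rightarrow> bool" where
  "nowhere_dense_in X S \<longleftrightarrow> S \<subseteq> topspace X \<and> X interior_of (X closure_of S) = {}"

definition first_category_in :: "'a topology \<Rightarrow> 'a set \<Rightarrow> bool" where
  "first_category_in X A \<longleftrightarrow>
     (\<exists>S :: nat \<Rightarrow> 'a set. (\<forall>n. nowhere_dense_in X (S n)) \<and> A = (\<Union>n. S n))"

definition typical_in :: "'a topology \<Rightarrow> ('a \<Rightarrow> bool) \<Rightarrow> bool" where
  "typical_in X P \<longleftrightarrow> first_category_in X {x \<in> topspace X. \<not> P x}"


section \<open>The space of nonempty compact subsets with the Hausdorff metric\<close>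

definition compact_subsets :: "'a::metric_space set \<Rightarrow> 'a set set" where
  "compact_subsets X = {E. E \<noteq> {} \<and> compact E \<and> E \<subseteq> X}"

definition open_nbhd :: "real \<Rightarrow> 'a::metric_space set \<Rightarrow> 'a set" where
  "open_nbhd \<epsilon> E = {x. infdist x E < \<epsilon>}"

definition hausdorff_radii :: "'a::metric_space set \<Rightarrow> 'a set \<Rightarrow> real set" where
  "hausdorff_radii E F = {\<epsilon>. \<epsilon> > 0 \<and> E \<subseteq> open_nbhd \<epsilon> F \<and> F \<subseteq> open_nbhd \<epsilon> E}"

text \<open>
  The case distinction only matters outside the nonempty compact sets, where there may be no
  admissible radius: there the infimum would be an unspecified real, whereas \<^locale>\<open>Metric_space\<close>
  requires nonnegativity for all arguments.
\<close>

definition hausdorff_dist :: "'a::metric_space set \<Rightarrow> 'a set \<Rightarrow> real" where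
  "hausdorff_dist E F = (if hausdorff_radii E F = {} then 0 else Inf (hausdorff_radii E F))"

definition hausdorff_topology :: "'a::metric_space set \<Rightarrow> 'a set topology" where
  "hausdorff_topology X = Metric_space.mtopology (compact_subsets X) hausdorff_dist"

lemma hausdorff_radii_nonempty:
  assumes "compact E" "compact F" "E \<noteq> {}" "F \<noteq> {}"
  shows "hausdorff_radii E F \<noteq> {}"
proof -
  obtain a b where a: "a \<in> E" and b: "b \<in> F" using assms by blast
  obtain r where r: "\<And>x. x \<in> E \<Longrightarrow> dist b x \<le> r"
    using assms(1) compact_imp_bounded bounded_any_center by metis
  obtain s where s: "\<And>x. x \<in> F \<Longrightarrow> dist a x \<le> s"
    using assms(2) compact_imp_bounded bounded_any_center by metis
  have "infdist x F < max r s + 1" if "x \<in> E" for x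
    using r[OF that] infdist_le[OF b, of x] by (simp add: dist_commute)
  moreover have "infdist x E < max r s + 1" if "x \<in> F" for x
    using s[OF that] infdist_le[OF a, of x] by (simp add: dist_commute)
  moreover have "max r s + 1 > 0"
    using r[OF a] zero_le_dist[of b a] by linarith
  ultimately have "max r s + 1 \<in> hausdorff_radii E F"
    by (auto simp: hausdorff_radii_def open_nbhd_def)
  then show ?thesis by blast
qed

lemma bdd_below_hausdorff_radii: "bdd_below (hausdorff_radii E F)"
  by (rule bdd_belowI[of _ 0]) (auto simp: hausdorff_radii_def)

lemma hausdorff_dist_nonneg: "0 \<le> hausdorff_dist E F"
  unfolding hausdorff_dist_def
  by (auto intro!: cInf_greatest simp: hausdorff_radii_def)

lemma radius_if_hausdorff_dist_less:
  assumes "compact E" "compact F" "E \<noteq> {}" "F \<noteq> {}" "hausdorff_dist E F < e"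
  shows "e \<in> hausdorff_radii E F"
proof -
  have "Inf (hausdorff_radii E F) < e"
    using assms hausdorff_radii_nonempty[of E F] by (simp add: hausdorff_dist_def)
  then obtain r where "r \<in> hausdorff_radii E F" "r < e"
    using cInf_lessD hausdorff_radii_nonempty[OF assms(1-4)] by blast
  then show ?thesis by (fastforce simp: hausdorff_radii_def open_nbhd_def)
qed

lemma hausdorff_dist_le:
  assumes "e \<in> hausdorff_radii E F"
  shows "hausdorff_dist E F \<le> e"
  using assms by (auto simp: hausdorff_dist_def intro: cInf_lower bdd_below_hausdorff_radii)

lemma Metric_space_hausdorff:
  "Metric_space (compact_subsets X) hausdorff_dist"
proof
  show "0 \<le> hausdorff_dist E F" for E F :: "'a set" by (rule hausdorff_dist_nonneg)
  show "hausdorff_dist E F = hausdorff_dist F E" for E F :: "'a set"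
  proof -
    have "hausdorff_radii E F = hausdorff_radii F E" by (auto simp: hausdorff_radii_def)
    then show ?thesis by (simp add: hausdorff_dist_def)
  qed
next
  fix E F assume "E \<in> compact_subsets X" "F \<in> compact_subsets X"
  then have EF: "compact E" "compact F" "E \<noteq> {}" "F \<noteq> {}"
    by (auto simp: compact_subsets_def)
  show "hausdorff_dist E F = 0 \<longleftrightarrow> E = F"
  proof
    assume "hausdorff_dist E F = 0"
    then have e: "e \<in> hausdorff_radii E F" if "e > 0" for e
      using radius_if_hausdorff_dist_less[OF EF] that by simp
    have "x \<in> F" if "x \<in> E" for x
    proof -
      have "infdist x F \<le> 0 + e" if "e > 0" for e
        using e[OF that] \<open>x \<in> E\<close> by (auto simp: hausdorff_radii_def open_nbhd_def)
      then have "infdist x F = 0" 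
        using infdist_nonneg[of x F] field_le_epsilon by (metis antisym)
      then show ?thesis using EF by (simp add: in_closed_iff_infdist_zero compact_imp_closed)
    qed
    moreover have "x \<in> E" if "x \<in> F" for x
    proof -
      have "infdist x E \<le> 0 + e" if "e > 0" for e
        using e[OF that] \<open>x \<in> F\<close> by (auto simp: hausdorff_radii_def open_nbhd_def)
      then have "infdist x E = 0" 
        using infdist_nonneg[of x E] field_le_epsilon by (metis antisym)
      then show ?thesis using EF by (simp add: in_closed_iff_infdist_zero compact_imp_closed)
    qed
    ultimately show "E = F" by blast
  next
    assume "E = F"
    then have "hausdorff_dist E F \<le> 0 + e" if "e > 0" for e
      using that by (auto intro!: hausdorff_dist_le simp: hausdorff_radii_def open_nbhd_def)
    then show "hausdorff_dist E F = 0"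
      using hausdorff_dist_nonneg[of E F] field_le_epsilon by (metis antisym)
  qed
next
  fix E F G
  assume "E \<in> compact_subsets X" "F \<in> compact_subsets X" "G \<in> compact_subsets X"
  then have c: "compact E" "compact F" "compact G" "E \<noteq> {}" "F \<noteq> {}" "G \<noteq> {}"
    by (auto simp: compact_subsets_def)
  have step: "infdist x C < r + s"
    if "infdist x B < r" "\<forall>y\<in>B. infdist y C < s" "B \<noteq> {}"
    for x :: 'a and B C r s
  proof -
    have "(INF y\<in>B. dist x y) < r" using that by (simp add: infdist_notempty)
    then obtain y where "y \<in> B" "dist x y < r"
      using cInf_lessD[of "dist x ` B" r] \<open>B \<noteq> {}\<close> by auto
    then show ?thesis using that infdist_triangle[of x C y] by force
  qed
  show "hausdorff_dist E G \<le> hausdorff_dist E F + hausdorff_dist F G"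
  proof (rule field_le_epsilon)
    fix e :: real assume "e > 0"
    define r where "r = hausdorff_dist E F + e/2"
    define s where "s = hausdorff_dist F G + e/2"
    have "r \<in> hausdorff_radii E F"
      by (rule radius_if_hausdorff_dist_less) (use c \<open>e > 0\<close> in \<open>auto simp: r_def\<close>)
    moreover have "s \<in> hausdorff_radii F G"
      by (rule radius_if_hausdorff_dist_less) (use c \<open>e > 0\<close> in \<open>auto simp: s_def\<close>)
    ultimately have "r + s \<in> hausdorff_radii E G"
      using step[of _ F r G s] step[of _ F s E r] c
      by (auto simp: hausdorff_radii_def open_nbhd_def subset_iff add.commute)
    then show "hausdorff_dist E G \<le> hausdorff_dist E F + hausdorff_dist F G + e"
      using hausdorff_dist_le[of "r + s" E G] by (simp add: r_def s_def)
  qed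
qed


section \<open>Normal numbers and Liouville numbers\<close>

text \<open>The base-\<open>b\<close> digits after the radix point; index \<open>0\<close> is the digit of weight \<open>1 / b\<close>.\<close>

definition base_digit :: "nat \<Rightarrow> real \<Rightarrow> nat \<Rightarrow> nat" where
  "base_digit b x i = nat \<lfloor>real b ^ Suc i * \<bar>x\<bar>\<rfloor> mod b"

definition normal_number :: "real \<Rightarrow> bool" where
  "normal_number x \<longleftrightarrow>
     (\<forall>b\<ge>2. \<forall>k\<ge>1. \<forall>w :: nat list. length w = k \<and> set w \<subseteq> {..<b} \<longrightarrow>
        (\<lambda>N. real (card {i. i < N \<and> (\<forall>j<k. base_digit b x (i + j) = w ! j)}) / real N)
          \<longlonglongrightarrow> 1 / real b ^ k)"

definition liouville_number :: "real \<Rightarrow> bool" where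
  "liouville_number x \<longleftrightarrow>
     x \<notin> \<rat> \<and>
     (\<forall>n::nat. n \<ge> 1 \<longrightarrow>
        (\<exists>p q :: int. q > 1 \<and> \<bar>x - real_of_int p / real_of_int q\<bar> < 1 / real_of_int q ^ n))"

end

theory Submission
  imports Defs
begin

text \<open>
  If \<open>S\<close> is nowhere dense, every compact set is approximated by finite sets avoiding the closure
  of \<open>S\<close>, and every compact set sufficiently close to such a finite set still misses \<open>S\<close>. So the
  compact sets meeting \<open>S\<close> form a nowhere dense family. For the second part it is then enough that
  the numbers that are normal or not Liouville form a set of first category: a non-Liouville
  number is rational or keeps distance \<open>1 / q ^ n\<close> from all fractions \<open>p / q\<close> for some fixed \<open>n\<close>;
  and just to the right of a dyadic rational there is an interval of numbers whose binary
  expansions contain arbitrarily long runs of zeros.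
\<close>

section \<open>Nowhere dense sets and sets of first category\<close>

text \<open>An open set missing \<open>S\<close> also misses its closure, so no nonempty one can sit
  inside the interior of that closure.\<close>

lemma nowhere_dense_inI:
  assumes "S \<subseteq> topspace X"
    and avoid: "\<And>U. openin X U \<Longrightarrow> U \<noteq> {} \<Longrightarrow> \<exists>V. openin X V \<and> V \<noteq> {} \<and> V \<subseteq> U \<and> V \<inter> S = {}"
  shows "nowhere_dense_in X S"
proof (rule ccontr)
  assume "\<not> nowhere_dense_in X S"
  then have "X interior_of (X closure_of S) \<noteq> {}"
    using assms(1) by (simp add: nowhere_dense_in_def)
  then obtain V where V: "openin X V" "V \<noteq> {}" "V \<subseteq> X interior_of (X closure_of S)" "V \<inter> S = {}"
    using avoid[OF openin_interior_of] by metis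
  then have "V \<inter> X closure_of S = {}"
    by (simp add: openin_Int_closure_of_eq_empty)
  then show False
    using V interior_of_subset[of X "X closure_of S"] by blast
qed

lemma nowhere_dense_in_subset:
  assumes "nowhere_dense_in X T" "S \<subseteq> T"
  shows "nowhere_dense_in X S"
  using assms interior_of_mono[OF closure_of_mono[OF assms(2)], of X X]
  by (auto simp: nowhere_dense_in_def)

text \<open>A countable cover suffices: intersecting its members with \<open>A\<close> keeps them
  nowhere dense and makes the union exactly \<open>A\<close>.\<close>

lemma first_category_inI:
  assumes "countable \<F>" "\<And>S. S \<in> \<F> \<Longrightarrow> nowhere_dense_in X S" "A \<subseteq> \<Union>\<F>"
  shows "first_category_in X A"
proof -
  \<comment> \<open>The extra empty set makes the family nonempty, so that
    \<open>from_nat_into\<close> enumerates it exactly.\<close>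
  let ?\<G> = "insert {} \<F>"
  define S where "S n = A \<inter> from_nat_into ?\<G> n" for n
  have range: "range (from_nat_into ?\<G>) = ?\<G>"
    using assms(1) by (intro range_from_nat_into) auto
  have "nowhere_dense_in X {}"
    by (simp add: nowhere_dense_in_def)
  then have "nowhere_dense_in X (from_nat_into ?\<G> n)" for n
    using assms(2) range by (metis insertE rangeI)
  then have "nowhere_dense_in X (S n)" for n
    by (rule nowhere_dense_in_subset[where T = "from_nat_into ?\<G> n"]) (simp add: S_def)
  moreover have "(\<Union>n. S n) = A \<inter> \<Union>(range (from_nat_into ?\<G>))"
    by (auto simp: S_def)
  then have "A = (\<Union>n. S n)"
    using assms(3) unfolding range by auto
  ultimately show ?thesis
    unfolding first_category_in_def by blast
qed


section \<open>Compact sets meeting a set of first category\<close>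

lemma topspace_hausdorff_topology [simp]:
  "topspace (hausdorff_topology X) = compact_subsets X"
  by (simp add: hausdorff_topology_def Metric_space.topspace_mtopology[OF Metric_space_hausdorff])

lemma openin_hausdorff_topology:
  "openin (hausdorff_topology X) \<U> \<longleftrightarrow> \<U> \<subseteq> compact_subsets X \<and>
     (\<forall>E\<in>\<U>. \<exists>r>0. \<forall>F\<in>compact_subsets X. hausdorff_dist E F < r \<longrightarrow> F \<in> \<U>)"
proof -
  interpret H: Metric_space "compact_subsets X" hausdorff_dist
    by (rule Metric_space_hausdorff)
  show ?thesis
    unfolding hausdorff_topology_def H.openin_mtopology subset_iff H.in_mball by blast
qed

lemma openin_hausdorff_ball:
  assumes "E \<in> compact_subsets X"
  shows "openin (hausdorff_topology X) {F \<in> compact_subsets X. hausdorff_dist E F < r}"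
proof -
  interpret H: Metric_space "compact_subsets X" hausdorff_dist
    by (rule Metric_space_hausdorff)
  have "{F \<in> compact_subsets X. hausdorff_dist E F < r} = H.mball E r"
    using assms by auto
  then show ?thesis
    by (simp add: hausdorff_topology_def H.openin_mball)
qed

lemma infdist_less_iff:
  assumes "A \<noteq> {}"
  shows "infdist x A < r \<longleftrightarrow> (\<exists>a\<in>A. dist x a < r)"
  using assms by (auto simp: infdist_notempty cINF_less_iff)

text \<open>Take a finite net of \<open>E\<close> and push each of its points slightly off the
  closure of \<open>S\<close>. Using the closure in the whole space makes its complement open
  there.\<close>

lemma finite_approximation_avoiding:
  assumes E: "E \<in> compact_subsets X" and S: "nowhere_dense_in (top_of_set X) S" and "r > 0"
  obtains F where "finite F" "F \<in> compact_subsets X" "F \<inter> closure S = {}" "hausdorff_dist E F < r"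
proof -
  have E': "E \<noteq> {}" "compact E" "E \<subseteq> X"
    using E by (auto simp: compact_subsets_def)
  \<comment> \<open>Net error \<open>r/4\<close> plus displacement \<open>r/4\<close> gives the
    radius \<open>r/2\<close>, which leaves room for the strict bound \<open>r\<close>.\<close>
  obtain C where C: "finite C" "C \<subseteq> E" "E \<subseteq> (\<Union>c\<in>C. ball c (r/4))"
    using compactE_image[OF E'(2), of E "\<lambda>c. ball c (r/4)"] \<open>r > 0\<close> by force
  \<comment> \<open>Otherwise a relative neighbourhood of \<open>c\<close> lies in
    \<open>X \<inter> closure S\<close>, the relative closure of \<open>S\<close>, contradicting
    nowhere density.\<close>
  have "\<exists>y\<in>X. y \<notin> closure S \<and> dist c y < r/4" if "c \<in> C" for c
  proof (rule ccontr)
    assume "\<not> ?thesis"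
    moreover have "S \<subseteq> X"
      using S by (simp add: nowhere_dense_in_def)
    ultimately have "X \<inter> ball c (r/4) \<subseteq> top_of_set X closure_of S"
      by (auto simp: closure_of_subtopology Int_absorb1)
    then have "X \<inter> ball c (r/4) \<subseteq> top_of_set X interior_of (top_of_set X closure_of S)"
      by (intro interior_of_maximal) (auto simp: openin_open)
    moreover have "c \<in> X \<inter> ball c (r/4)"
      using that C E' \<open>r > 0\<close> by auto
    ultimately show False
      using S unfolding nowhere_dense_in_def by blast
  qed
  then obtain f where f: "\<And>c. c \<in> C \<Longrightarrow> f c \<in> X \<and> f c \<notin> closure S \<and> dist c (f c) < r/4"
    by metis
  have "C \<noteq> {}"
    using C E' by auto
  have F: "f ` C \<in> compact_subsets X"
    using f C \<open>C \<noteq> {}\<close> by (auto simp: compact_subsets_def intro: finite_imp_compact)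
  have "infdist x (f ` C) < r/2" if x: "x \<in> E" for x
  proof -
    obtain c where c: "c \<in> C" "dist c x < r/4"
      using C x by auto
    then have "dist x (f c) < r/2"
      using f[OF c(1)] dist_triangle[of x "f c" c] by (simp add: dist_commute)
    then show ?thesis
      using infdist_le[of "f c" "f ` C" x] c(1) by simp
  qed
  moreover have "infdist (f c) E < r/2" if "c \<in> C" for c
    using infdist_le[of c E "f c"] f[OF that] that C(2) \<open>r > 0\<close> by (force simp: dist_commute)
  ultimately have "r/2 \<in> hausdorff_radii E (f ` C)"
    using \<open>r > 0\<close> by (auto simp: hausdorff_radii_def open_nbhd_def)
  then have "hausdorff_dist E (f ` C) < r"
    using hausdorff_dist_le[of "r/2" E "f ` C"] \<open>r > 0\<close> by simp
  with F f C(1) show thesis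
    by (intro that[of "f ` C"]) auto
qed

lemma nowhere_dense_in_hausdorff_meeting:
  assumes S: "nowhere_dense_in (top_of_set X) S"
  shows "nowhere_dense_in (hausdorff_topology X) {E \<in> compact_subsets X. E \<inter> S \<noteq> {}}"
proof (rule nowhere_dense_inI)
  fix \<U> assume \<U>: "openin (hausdorff_topology X) \<U>" "\<U> \<noteq> {}"
  then obtain E r where E: "E \<in> compact_subsets X" "r > 0"
    and r: "\<And>F. F \<in> compact_subsets X \<Longrightarrow> hausdorff_dist E F < r \<Longrightarrow> F \<in> \<U>"
    unfolding openin_hausdorff_topology by blast
  obtain F where F: "F \<in> compact_subsets X" "F \<inter> closure S = {}" "hausdorff_dist E F < r"
    using finite_approximation_avoiding[OF E(1) S E(2)] by metis
  then have F': "compact F" "F \<noteq> {}"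
    by (auto simp: compact_subsets_def)
  \<comment> \<open>Compactness of \<open>F\<close> gives one distance \<open>d\<close> that works
    at all its points.\<close>
  have "open (- closure S)" "F \<subseteq> - closure S"
    using F(2) by auto
  then obtain d where d: "d > 0" "(\<Union>x\<in>F. ball x d) \<subseteq> - closure S"
    by (rule compact_subset_open_imp_ball_epsilon_subset[OF F'(1)])
  define \<V> where "\<V> = {G \<in> compact_subsets X. hausdorff_dist F G < d}"
  have "G \<inter> S = {}" if "G \<in> \<V>" for G
  proof (rule ccontr)
    assume "G \<inter> S \<noteq> {}"
    then obtain x where x: "x \<in> G" "x \<in> S" by blast
    have "compact G" "G \<noteq> {}" "hausdorff_dist F G < d"
      using that by (simp_all add: \<V>_def compact_subsets_def)
    then have "d \<in> hausdorff_radii F G"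
      using F' by (intro radius_if_hausdorff_dist_less)
    then have "infdist x F < d"
      using x by (auto simp: hausdorff_radii_def open_nbhd_def)
    then obtain y where "y \<in> F" "dist x y < d"
      using F' by (auto simp: infdist_less_iff)
    then have "x \<in> (\<Union>x\<in>F. ball x d)"
      by (auto simp: dist_commute)
    then show False
      using d(2) x(2) closure_subset[of S] by blast
  qed
  \<comment> \<open>The ball \<open>\<V>\<close> may stick out of \<open>\<U>\<close>; the
    intersection is still nonempty, as it contains \<open>F\<close>.\<close>
  moreover have "openin (hausdorff_topology X) (\<V> \<inter> \<U>)"
    using \<U> openin_hausdorff_ball[OF F(1)] unfolding \<V>_def by (intro openin_Int)
  moreover have "hausdorff_dist F F = 0"
    using Metric_space.mdist_zero[OF Metric_space_hausdorff F(1)] .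
  then have "F \<in> \<V> \<inter> \<U>"
    using r F d(1) by (simp add: \<V>_def)
  ultimately show "\<exists>\<V>. openin (hausdorff_topology X) \<V> \<and> \<V> \<noteq> {} \<and> \<V> \<subseteq> \<U>
      \<and> \<V> \<inter> {E \<in> compact_subsets X. E \<inter> S \<noteq> {}} = {}"
    by (intro exI[of _ "\<V> \<inter> \<U>"]) blast
qed (simp add: Collect_restrict)

text \<open>A set meets a union exactly when it meets one of the members. The general
  \<open>X\<close> serves both the cube and the interval.\<close>

lemma first_category_in_hausdorff_meeting:
  assumes "first_category_in (top_of_set X) A"
  shows "first_category_in (hausdorff_topology X) {E \<in> compact_subsets X. E \<inter> A \<noteq> {}}"
proof -
  obtain S :: "nat \<Rightarrow> 'a set"
    where S: "\<And>n. nowhere_dense_in (top_of_set X) (S n)" "A = (\<Union>n. S n)"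
    using assms unfolding first_category_in_def by blast
  show ?thesis
    by (rule first_category_inI[of "range (\<lambda>n. {E \<in> compact_subsets X. E \<inter> S n \<noteq> {}})"])
      (use S nowhere_dense_in_hausdorff_meeting in auto)
qed


section \<open>Normal numbers and non-Liouville numbers\<close>

text \<open>Reduces relatively open sets, which may contain endpoints, to open subintervals.
  \<open>T\<close> itself need not lie in the subinterval.\<close>

lemma nowhere_dense_in_unit_intervalI:
  fixes S :: "real set"
  assumes "S \<subseteq> {0..1}"
    and avoid: "\<And>u v. 0 \<le> u \<Longrightarrow> u < v \<Longrightarrow> v \<le> 1 \<Longrightarrow>
      \<exists>T. open T \<and> T \<inter> {u<..<v} \<noteq> {} \<and> T \<inter> {u<..<v} \<inter> S = {}"
  shows "nowhere_dense_in (top_of_set {0..1}) S"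
proof (rule nowhere_dense_inI)
  fix U assume "openin (top_of_set {0..1::real}) U" "U \<noteq> {}"
  then obtain W where W: "open W" "U = {0..1} \<inter> W"
    by (auto simp: openin_open)
  \<comment> \<open>The open interval is dense in \<open>{0..1}\<close>, so an open \<open>W\<close>
    meeting the latter meets the former.\<close>
  have "W \<inter> closure {0<..<1} \<noteq> {}"
    using W \<open>U \<noteq> {}\<close> by auto
  then have "W \<inter> {0<..<1} \<noteq> {}"
    using open_Int_closure_eq_empty[OF W(1)] by metis
  then obtain z where z: "z \<in> W \<inter> {0<..<1}" by blast
  moreover have "open (W \<inter> {0<..<1})"
    using W by auto
  ultimately obtain e where e: "e > 0" "ball z e \<subseteq> W \<inter> {0<..<1}"
    using open_contains_ball by metis
  \<comment> \<open>Halving \<open>e\<close> keeps even the endpoints inside the ball, whence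
    \<open>0 \<le> u\<close> and \<open>v \<le> 1\<close>.\<close>
  define u v where "u = z - e/2" "v = z + e/2"
  have uv: "{u..v} \<subseteq> W \<inter> {0<..<1}"
    by (rule order_trans[OF _ e(2)]) (use e(1) in \<open>auto simp: u_v_def dist_real_def\<close>)
  have "u < v"
    using e(1) by (simp add: u_v_def)
  moreover have "u \<in> {u..v}" "v \<in> {u..v}"
    using \<open>u < v\<close> by auto
  then have "0 \<le> u" "v \<le> 1"
    using uv by (auto simp: subset_iff)
  ultimately obtain T where T: "open T" "T \<inter> {u<..<v} \<noteq> {}" "T \<inter> {u<..<v} \<inter> S = {}"
    using avoid[of u v] by metis
  have "{0<..<1} \<subseteq> {0..1::real}" "{u<..<v} \<subseteq> {u..v}"
    by auto
  then have sub: "T \<inter> {u<..<v} \<subseteq> U" and "T \<inter> {u<..<v} \<subseteq> {0..1}"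
    using uv W(2) by blast+
  then have "openin (top_of_set {0..1}) (T \<inter> {u<..<v})"
    using T(1) by (simp add: openin_open_eq open_Int open_subset)
  with T sub show "\<exists>V. openin (top_of_set {0..1}) V \<and> V \<noteq> {} \<and> V \<subseteq> U \<and> V \<inter> S = {}"
    by blast
qed (use assms in auto)

lemma nowhere_dense_in_unit_interval_singleton:
  assumes "x \<in> {0..1::real}"
  shows "nowhere_dense_in (top_of_set {0..1}) {x}"
proof (rule nowhere_dense_in_unit_intervalI)
  fix u v :: real assume "u < v"
  then have "infinite {u<..<v}" by simp
  then have "\<not> {u<..<v} \<subseteq> {x}"
    using finite_subset by blast
  then show "\<exists>T. open T \<and> T \<inter> {u<..<v} \<noteq> {} \<and> T \<inter> {u<..<v} \<inter> {x} = {}"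
    by (intro exI[of _ "- {x}"]) auto
qed (use assms in auto)

definition badly_approximable_unit :: "nat \<Rightarrow> real set" where
  "badly_approximable_unit n = {x \<in> {0..1}. \<forall>p q :: int. q > 1 \<longrightarrow>
     \<bar>x - real_of_int p / real_of_int q\<bar> \<ge> 1 / real_of_int q ^ n}"

text \<open>Each fraction \<open>p / q\<close> with \<open>q > 1\<close> has the ball of radius
  \<open>1 / q ^ n\<close> around it free of such points, and these fractions are dense.\<close>

lemma nowhere_dense_in_badly_approximable_unit:
  "nowhere_dense_in (top_of_set {0..1}) (badly_approximable_unit n)"
proof (rule nowhere_dense_in_unit_intervalI)
  fix u v :: real assume "u < v"
  then obtain r where r: "r \<in> \<rat>" "u < r" "r < v"
    using Rats_dense_in_real by blast
  then obtain a b :: int where "b > 0" "r = real_of_int a / real_of_int b"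
    by (metis Rats_cases')
  \<comment> \<open>Doubling numerator and denominator excludes the denominator 1.\<close>
  then obtain p q :: int where q: "q > 1" "r = real_of_int p / real_of_int q"
    by (intro that[of "2 * b" "2 * a"]) auto
  let ?T = "ball r (1 / real_of_int q ^ n)"
  have "r \<in> ?T \<inter> {u<..<v}"
    using r q(1) by simp
  moreover have "x \<notin> badly_approximable_unit n" if "x \<in> ?T" for x
  proof -
    have "\<not> 1 / real_of_int q ^ n \<le> \<bar>x - real_of_int p / real_of_int q\<bar>"
      using that q(2) by (simp add: dist_real_def abs_minus_commute)
    then show ?thesis
      using q(1) unfolding badly_approximable_unit_def by blast
  qed
  ultimately show "\<exists>T. open T \<and> T \<inter> {u<..<v} \<noteq> {} \<and> T \<inter> {u<..<v} \<inter> badly_approximable_unit n = {}"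
    by (intro exI[of _ ?T] conjI open_ball) blast+
qed (auto simp: badly_approximable_unit_def)

lemma not_liouville_number_cases:
  assumes "x \<in> {0..1}" "\<not> liouville_number x"
  shows "x \<in> \<rat> \<or> (\<exists>n. x \<in> badly_approximable_unit n)"
  using assms unfolding liouville_number_def badly_approximable_unit_def mem_Collect_eq by (meson not_less)

text \<open>Fixing the start \<open>M\<close> of the bound turns an eventual property into a
  countable union. The threshold lies strictly between the normal frequency \<open>1/2\<close> and
  the frequency \<open>1\<close> that long runs of zeros approach.\<close>

definition few_zeros_unit :: "nat \<Rightarrow> real set" where
  "few_zeros_unit M = {x \<in> {0..1}. \<forall>N\<ge>M.
     real (card {i. i < N \<and> base_digit 2 x i = 0}) / real N < 3/4}"

text \<open>Only base 2 and the one-digit block \<open>[0]\<close> enter: their limit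
  \<open>1/2\<close> is below \<open>3/4\<close>.\<close>

lemma normal_number_few_zeros:
  assumes "x \<in> {0..1}" "normal_number x"
  shows "\<exists>M. x \<in> few_zeros_unit M"
proof -
  have "(\<lambda>N. real (card {i. i < N \<and> (\<forall>j<1. base_digit 2 x (i + j) = [0] ! j)}) / real N)
      \<longlonglongrightarrow> 1 / real 2 ^ 1"
    using assms(2)[unfolded normal_number_def, rule_format, of 2 1 "[0]"] by simp
  then have "(\<lambda>N. real (card {i. i < N \<and> base_digit 2 x i = 0}) / real N) \<longlonglongrightarrow> 1/2"
    by simp
  then have "\<forall>\<^sub>F N in sequentially. real (card {i. i < N \<and> base_digit 2 x i = 0}) / real N < 3/4"
    by (rule order_tendstoD) simp
  then show ?thesis
    using assms(1) by (auto simp: eventually_sequentially few_zeros_unit_def)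
qed

text \<open>Scaling by \<open>2 ^ Suc i\<close> turns the dyadic point into an even integer, and the
  interval to its right into one of length at most 1. So the floor is that integer and the digit is
  its parity.\<close>

lemma base_digit_2_right_of_dyadic:
  assumes "real a / 2 ^ m < x" "x < real a / 2 ^ m + 1 / 2 ^ N" "m \<le> i" "i < N"
  shows "base_digit 2 x i = 0"
proof -
  have "0 \<le> real a / 2 ^ m" by simp
  then have "x > 0"
    using assms(1) by linarith
  have scale: "2 ^ Suc i * (real a / 2 ^ m) = real (a * 2 ^ (Suc i - m))"
    using assms(3) power_add[of "2::real" "Suc i - m" m] by (simp add: field_simps)
  have "(2::real) ^ Suc i \<le> 2 ^ N"
    using assms(4) by (intro power_increasing) auto
  then have "2 ^ Suc i * (1 / 2 ^ N) \<le> (1::real)"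
    by (simp add: field_simps)
  moreover have "2 ^ Suc i * x < 2 ^ Suc i * (real a / 2 ^ m + 1 / 2 ^ N)"
    using assms(2) by (intro mult_strict_left_mono) auto
  ultimately have "2 ^ Suc i * x < real (a * 2 ^ (Suc i - m)) + 1"
    unfolding distrib_left scale by linarith
  moreover have "2 ^ Suc i * (real a / 2 ^ m) < 2 ^ Suc i * x"
    using assms(1) by (intro mult_strict_left_mono) auto
  then have "real (a * 2 ^ (Suc i - m)) \<le> 2 ^ Suc i * x"
    unfolding scale by simp
  ultimately have "\<lfloor>2 ^ Suc i * x\<rfloor> = int (a * 2 ^ (Suc i - m))"
    by (intro floor_unique) auto
  \<comment> \<open>The exponent is at least 1 because \<open>m \<le> i\<close>.\<close>
  moreover have "even (a * 2 ^ (Suc i - m))"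
    using assms(3) by simp
  ultimately show ?thesis
    using \<open>x > 0\<close> by (simp add: base_digit_def del: power_Suc of_nat_mult)
qed

lemma nowhere_dense_in_few_zeros_unit:
  "nowhere_dense_in (top_of_set {0..1}) (few_zeros_unit M)"
proof (rule nowhere_dense_in_unit_intervalI)
  fix u v :: real assume uv: "0 \<le> u" "u < v"
  obtain m where m: "(1/2) ^ m < v - u"
    using real_arch_pow_inv[of "v - u" "1/2"] uv by auto
  \<comment> \<open>The least integer strictly above \<open>u * 2 ^ m\<close>, also when that number
    is an integer. As the mesh \<open>1 / 2 ^ m\<close> is below \<open>v - u\<close>, the point
    \<open>a / 2 ^ m\<close> falls inside the interval.\<close>
  define a where "a = nat (\<lfloor>u * 2 ^ m\<rfloor> + 1)"
  have "0 \<le> \<lfloor>u * 2 ^ m\<rfloor>"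
    using uv(1) by simp
  then have "real a = real_of_int \<lfloor>u * 2 ^ m\<rfloor> + 1"
    by (simp add: a_def)
  moreover have "1 < (v - u) * 2 ^ m"
    using m by (simp add: power_one_over field_simps)
  ultimately have "u * 2 ^ m < real a" "real a < v * 2 ^ m"
    unfolding left_diff_distrib by linarith+
  then have a: "u < real a / 2 ^ m" "real a / 2 ^ m < v"
    by (simp_all add: field_simps)
  \<comment> \<open>Of the first \<open>N\<close> digits all but the first \<open>m\<close> vanish on \<open>T\<close>, and \<open>m < N / 4\<close>.\<close>
  define N where "N = 4 * m + 4 + M"
  let ?T = "{real a / 2 ^ m <..< real a / 2 ^ m + 1 / 2 ^ N}"
  have "x \<notin> few_zeros_unit M" if x: "x \<in> ?T" for x
  proof -
    have "{m..<N} \<subseteq> {i. i < N \<and> base_digit 2 x i = 0}"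
      using x base_digit_2_right_of_dyadic[of a m x N] by auto
    then have "card {m..<N} \<le> card {i. i < N \<and> base_digit 2 x i = 0}"
      by (intro card_mono) auto
    then have "3/4 * real N \<le> real (card {i. i < N \<and> base_digit 2 x i = 0})"
      by (simp add: N_def)
    then have "3/4 \<le> real (card {i. i < N \<and> base_digit 2 x i = 0}) / real N"
      by (subst le_divide_eq) (auto simp: N_def)
    \<comment> \<open>This puts \<open>N\<close> in the range where membership in
      \<open>few_zeros_unit M\<close> would force a frequency below \<open>3/4\<close>.\<close>
    moreover have "M \<le> N"
      by (simp add: N_def)
    ultimately show ?thesis
      unfolding few_zeros_unit_def mem_Collect_eq by (meson not_less)
  qed
  \<comment> \<open>\<open>?T\<close> may extend beyond \<open>v\<close>, so the common point is
    taken close enough to its left end.\<close>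
  moreover obtain z where "real a / 2 ^ m < z" "z < min v (real a / 2 ^ m + 1 / 2 ^ N)"
    using dense[of "real a / 2 ^ m" "min v (real a / 2 ^ m + 1 / 2 ^ N)"] a by auto
  then have "z \<in> ?T \<inter> {u<..<v}"
    using a by auto
  ultimately show "\<exists>T. open T \<and> T \<inter> {u<..<v} \<noteq> {} \<and> T \<inter> {u<..<v} \<inter> few_zeros_unit M = {}"
    by (intro exI[of _ ?T] conjI open_greaterThanLessThan) blast+
qed (auto simp: few_zeros_unit_def)

lemma first_category_in_normal_or_not_liouville:
  "first_category_in (top_of_set {0..1}) {x \<in> {0..1}. normal_number x \<or> \<not> liouville_number x}"
proof (rule first_category_inI)
  let ?\<F> = "(\<lambda>x. {x}) ` (\<rat> \<inter> {0..1}) \<union> range badly_approximable_unit \<union> range few_zeros_unit"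
  show "countable ?\<F>"
    by (simp add: countable_rat)
  show "nowhere_dense_in (top_of_set {0..1}) S" if "S \<in> ?\<F>" for S
    using that nowhere_dense_in_unit_interval_singleton nowhere_dense_in_badly_approximable_unit
      nowhere_dense_in_few_zeros_unit by blast
  show "{x \<in> {0..1}. normal_number x \<or> \<not> liouville_number x} \<subseteq> \<Union>?\<F>"
  proof
    fix x assume "x \<in> {x \<in> {0..1}. normal_number x \<or> \<not> liouville_number x}"
    then have x: "x \<in> {0..1}" "normal_number x \<or> \<not> liouville_number x" by auto
    then have "x \<in> \<rat> \<or> (\<exists>n. x \<in> badly_approximable_unit n) \<or> (\<exists>M. x \<in> few_zeros_unit M)"
      using not_liouville_number_cases[OF x(1)] normal_number_few_zeros[OF x(1)] by metis
    then show "x \<in> \<Union>?\<F>"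
      using x(1) by auto
  qed
qed

theorem corollary1p4:
  shows "(\<forall>A :: (real ^ 'n) set.
            A \<subseteq> cbox 0 1 \<and> first_category_in (top_of_set (cbox 0 1)) A \<longrightarrow>
            first_category_in (hausdorff_topology (cbox 0 1 :: (real ^ 'n) set))
              {E \<in> compact_subsets (cbox 0 1). E \<inter> A \<noteq> {}})
         \<and> typical_in (hausdorff_topology {0..1::real})
             (\<lambda>E. E \<subseteq> {x. liouville_number x \<and> \<not> normal_number x})"
proof (intro conjI allI impI)
  show "first_category_in (hausdorff_topology (cbox 0 1)) {E \<in> compact_subsets (cbox 0 1). E \<inter> A \<noteq> {}}"
    if "A \<subseteq> cbox 0 1 \<and> first_category_in (top_of_set (cbox 0 1)) A" for A :: "(real ^ 'n) set"
    using that by (intro first_category_in_hausdorff_meeting) simp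
next
  \<comment> \<open>Since \<open>E\<close> lies in the unit interval, failing the inclusion means
    meeting the exceptional set, so the first-category transfer applies.\<close>
  have "{E \<in> compact_subsets {0..1}. \<not> E \<subseteq> {x. liouville_number x \<and> \<not> normal_number x}}
      = {E \<in> compact_subsets {0..1}. E \<inter> {x \<in> {0..1}. normal_number x \<or> \<not> liouville_number x} \<noteq> {}}"
    unfolding compact_subsets_def by blast
  then show "typical_in (hausdorff_topology {0..1::real})
      (\<lambda>E. E \<subseteq> {x. liouville_number x \<and> \<not> normal_number x})"
    using first_category_in_hausdorff_meeting[OF first_category_in_normal_or_not_liouville]
    unfolding typical_in_def topspace_hausdorff_topology by (rule ssubst)
qed

end
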